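(* For every $\lambda$-variable $x$, term $t$ and value $v$, $(\lambda x\,t)\,v\equiv t[x:=v]$; and for all constructors $C_1,\dots,C_n$, $\lambda$-variables $x_1,\dots,x_n$, terms $t_1,\dots,t_n$, value $v$ and every $k$ with $1\le k\le n$, $\mathrm{case}_{C_k[v]}[C_i[x_i]\to t_i]_{1\le i\le n}\equiv t_k[x_k:=v]$.
   Context: Fix pairwise disjoint countably infinite sets of $\lambda$-variables ($x,y,\dots$), stack variables ($\alpha,\beta,\dots$), term variables ($a,b,\dots$), and countable sets of labels $l$ and constructors $C$. Values, terms, stacks, processes: $v,w::=x\mid\lambda x\,t\mid C[v]\mid\{l_i=v_i\}_{i\in I}$; $t,u::=a\mid v\mid t\,u\mid\mu\alpha\,t\mid p\mid v.l\mid\mathrm{case}_v[C_i[x_i]\to t_i]_{i\in I}\mid\delta_{v,w}$; $\pi::=\alpha\mid v.\pi\mid[t]\pi$; $p::=t\ast\pi$; $I$ finite; $\lambda x$, $\mu\alpha$ and the $x_i$ in case branches are binders, term variables are never bound. Substitutions map $\lambda$-variables to values, stack variables to stacks, term variables to terms (capture-avoiding). $\succ$ is the smallest relation on processes with: $t\,u\ast\pi\succ u\ast[t]\pi$; $v\ast[t]\pi\succ t\ast v.\pi$; $\lambda x\,t\ast v.\pi\succ t[x:=v]\ast\pi$; $\mu\alpha\,t\ast\pi\succ t[\alpha:=\pi]\ast\pi$; $p\ast\pi\succ p$; $\{l_i=v_i\}_{i\in I}.l_k\ast\pi\succ v_k\ast\pi$ ($k\in I$); $\mathrm{case}_{C_k[v]}[C_i[x_i]\to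 t_i]_{i\in I}\ast\pi\succ t_k[x_k:=v]\ast\pi$ ($k\in I$). A process is final if it is $v\ast\alpha$ with $v$ a value and $\alpha$ a stack variable; for a relation $R$, $p\Downarrow_R$ means $p\,R^*\,q$ with $q$ final. For $i\in\mathbb N$, inductively: $\rightsquigarrow_i=\succ\cup\{(\delta_{v,w}\ast\pi,v\ast\pi)\mid\exists j<i,\ v\not\equiv_jw\}$; $t\equiv_iu$ iff for all $j\le i$, stacks $\pi$, substitutions $\sigma$: $t\sigma\ast\pi\Downarrow_{\rightsquigarrow_j}\Leftrightarrow u\sigma\ast\pi\Downarrow_{\rightsquigarrow_j}$; $\not\equiv_i$ is its negation. $\equiv=\bigcap_i\equiv_i$.
   Formalization: The constructors C_1,…,C_n of a case (and the labels of a record) are taken pairwise distinct; with a repeated constructor, reduction may pick another branch and the second claim fails, e.g. C_1=C_2, t_1 a value, t_2 diverging, k=2. *)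

theory Defs
  imports "HOL-Library.Finite_Map" "HOL-Library.Countable"
begin

text \<open>
  Syntax up to alpha-equivalence, in de Bruijn form. \<open>\<lambda>\<close>-variables and stack variables have two
  separate index spaces: \<open>Lam\<close> and every branch of \<open>Case\<close> bind \<open>\<lambda>\<close>-index 0, and \<open>Mu\<close> binds
  stack index 0. At the outermost level an index is a name, so a free variable with name \<open>x\<close>
  is \<open>Var x\<close>, and it is \<open>Var (x + d)\<close> below \<open>d\<close> binders of its kind. The named binders
  are \<open>lam\<close>, \<open>mu\<close> and \<open>case_of\<close> below.

  Records and lists of branches are finite maps. So the labels (constructors) in one of them are
  pairwise distinct, and the order in which they are listed does not matter.
\<close>

datatype ('l, 'c) val =
    Var nat
  | Lam "('l, 'c) trm"
  | Con 'c "('l, 'c) val"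
  | Rec "('l, ('l, 'c) val) fmap"
and ('l, 'c) trm =
    TVar nat
  | Val "('l, 'c) val"
  | App "('l, 'c) trm" "('l, 'c) trm"
  | Mu "('l, 'c) trm"
  | Prc "('l, 'c) proc"
  | Proj "('l, 'c) val" 'l
  | Case "('l, 'c) val" "('c, ('l, 'c) trm) fmap"
  | Delta "('l, 'c) val" "('l, 'c) val"
and ('l, 'c) stk =
    SVar nat
  | Push "('l, 'c) val" "('l, 'c) stk"
  | Frame "('l, 'c) trm" "('l, 'c) stk"
and ('l, 'c) proc =
    Proc "('l, 'c) trm" "('l, 'c) stk"  (infix "\<star>" 60)


section \<open>Renaming and capture-avoiding substitution\<close>

definition up :: "(nat \<Rightarrow> nat) \<Rightarrow> nat \<Rightarrow> nat" where
  "up f = case_nat 0 (\<lambda>n. Suc (f n))"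

text \<open>\<open>f\<close> renames \<open>\<lambda>\<close>-variables and \<open>g\<close> renames stack variables.\<close>

primrec ren_val :: "(nat \<Rightarrow> nat) \<Rightarrow> (nat \<Rightarrow> nat) \<Rightarrow> ('l, 'c) val \<Rightarrow> ('l, 'c) val"
  and ren_trm :: "(nat \<Rightarrow> nat) \<Rightarrow> (nat \<Rightarrow> nat) \<Rightarrow> ('l, 'c) trm \<Rightarrow> ('l, 'c) trm"
  and ren_stk :: "(nat \<Rightarrow> nat) \<Rightarrow> (nat \<Rightarrow> nat) \<Rightarrow> ('l, 'c) stk \<Rightarrow> ('l, 'c) stk"
  and ren_proc :: "(nat \<Rightarrow> nat) \<Rightarrow> (nat \<Rightarrow> nat) \<Rightarrow> ('l, 'c) proc \<Rightarrow> ('l, 'c) proc"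
where
  "ren_val f g (Var x) = Var (f x)"
| "ren_val f g (Lam t) = Lam (ren_trm (up f) g t)"
| "ren_val f g (Con c v) = Con c (ren_val f g v)"
| "ren_val f g (Rec r) = Rec (fmmap (ren_val f g) r)"
| "ren_trm f g (TVar a) = TVar a"
| "ren_trm f g (Val v) = Val (ren_val f g v)"
| "ren_trm f g (App t u) = App (ren_trm f g t) (ren_trm f g u)"
| "ren_trm f g (Mu t) = Mu (ren_trm f (up g) t)"
| "ren_trm f g (Prc p) = Prc (ren_proc f g p)"
| "ren_trm f g (Proj v l) = Proj (ren_val f g v) l"
| "ren_trm f g (Case v bs) = Case (ren_val f g v) (fmmap (ren_trm (up f) g) bs)"
| "ren_trm f g (Delta v w) = Delta (ren_val f g v) (ren_val f g w)"
| "ren_stk f g (SVar \<alpha>) = SVar (g \<alpha>)"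
| "ren_stk f g (Push v \<pi>) = Push (ren_val f g v) (ren_stk f g \<pi>)"
| "ren_stk f g (Frame t \<pi>) = Frame (ren_trm f g t) (ren_stk f g \<pi>)"
| "ren_proc f g (t \<star> \<pi>) = ren_trm f g t \<star> ren_stk f g \<pi>"

text \<open>
  A substitution is given by three maps: \<open>\<rho>\<close> on \<open>\<lambda>\<close>-variables, \<open>\<sigma>\<close> on stack variables and
  \<open>\<tau>\<close> on term variables. The operations \<open>_l\<close> and \<open>_s\<close> push them below a \<open>\<lambda>\<close>-binder and below a
  \<open>\<mu>\<close>-binder respectively, shifting the free variables of the images so that none is captured. The maps may have
  infinite support.
\<close>

definition val_l :: "(nat \<Rightarrow> ('l, 'c) val) \<Rightarrow> nat \<Rightarrow> ('l, 'c) val" where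
  "val_l \<rho> = case_nat (Var 0) (\<lambda>n. ren_val Suc id (\<rho> n))"
definition stk_l :: "(nat \<Rightarrow> ('l, 'c) stk) \<Rightarrow> nat \<Rightarrow> ('l, 'c) stk" where
  "stk_l \<sigma> = (\<lambda>n. ren_stk Suc id (\<sigma> n))"
definition trm_l :: "(nat \<Rightarrow> ('l, 'c) trm) \<Rightarrow> nat \<Rightarrow> ('l, 'c) trm" where
  "trm_l \<tau> = (\<lambda>n. ren_trm Suc id (\<tau> n))"

definition val_s :: "(nat \<Rightarrow> ('l, 'c) val) \<Rightarrow> nat \<Rightarrow> ('l, 'c) val" where
  "val_s \<rho> = (\<lambda>n. ren_val id Suc (\<rho> n))"
definition stk_s :: "(nat \<Rightarrow> ('l, 'c) stk) \<Rightarrow> nat \<Rightarrow> ('l, 'c) stk" where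
  "stk_s \<sigma> = case_nat (SVar 0) (\<lambda>n. ren_stk id Suc (\<sigma> n))"
definition trm_s :: "(nat \<Rightarrow> ('l, 'c) trm) \<Rightarrow> nat \<Rightarrow> ('l, 'c) trm" where
  "trm_s \<tau> = (\<lambda>n. ren_trm id Suc (\<tau> n))"

primrec sub_val :: "(nat \<Rightarrow> ('l, 'c) val) \<Rightarrow> (nat \<Rightarrow> ('l, 'c) stk) \<Rightarrow> (nat \<Rightarrow> ('l, 'c) trm) \<Rightarrow>
    ('l, 'c) val \<Rightarrow> ('l, 'c) val"
  and sub_trm :: "(nat \<Rightarrow> ('l, 'c) val) \<Rightarrow> (nat \<Rightarrow> ('l, 'c) stk) \<Rightarrow> (nat \<Rightarrow> ('l, 'c) trm) \<Rightarrow>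
    ('l, 'c) trm \<Rightarrow> ('l, 'c) trm"
  and sub_stk :: "(nat \<Rightarrow> ('l, 'c) val) \<Rightarrow> (nat \<Rightarrow> ('l, 'c) stk) \<Rightarrow> (nat \<Rightarrow> ('l, 'c) trm) \<Rightarrow>
    ('l, 'c) stk \<Rightarrow> ('l, 'c) stk"
  and sub_proc :: "(nat \<Rightarrow> ('l, 'c) val) \<Rightarrow> (nat \<Rightarrow> ('l, 'c) stk) \<Rightarrow> (nat \<Rightarrow> ('l, 'c) trm) \<Rightarrow>
    ('l, 'c) proc \<Rightarrow> ('l, 'c) proc"
where
  "sub_val \<rho> \<sigma> \<tau> (Var x) = \<rho> x"
| "sub_val \<rho> \<sigma> \<tau> (Lam t) = Lam (sub_trm (val_l \<rho>) (stk_l \<sigma>) (trm_l \<tau>) t)"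
| "sub_val \<rho> \<sigma> \<tau> (Con c v) = Con c (sub_val \<rho> \<sigma> \<tau> v)"
| "sub_val \<rho> \<sigma> \<tau> (Rec r) = Rec (fmmap (sub_val \<rho> \<sigma> \<tau>) r)"
| "sub_trm \<rho> \<sigma> \<tau> (TVar a) = \<tau> a"
| "sub_trm \<rho> \<sigma> \<tau> (Val v) = Val (sub_val \<rho> \<sigma> \<tau> v)"
| "sub_trm \<rho> \<sigma> \<tau> (App t u) = App (sub_trm \<rho> \<sigma> \<tau> t) (sub_trm \<rho> \<sigma> \<tau> u)"
| "sub_trm \<rho> \<sigma> \<tau> (Mu t) = Mu (sub_trm (val_s \<rho>) (stk_s \<sigma>) (trm_s \<tau>) t)"
| "sub_trm \<rho> \<sigma> \<tau> (Prc p) = Prc (sub_proc \<rho> \<sigma> \<tau> p)"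
| "sub_trm \<rho> \<sigma> \<tau> (Proj v l) = Proj (sub_val \<rho> \<sigma> \<tau> v) l"
| "sub_trm \<rho> \<sigma> \<tau> (Case v bs) = Case (sub_val \<rho> \<sigma> \<tau> v)
    (fmmap (sub_trm (val_l \<rho>) (stk_l \<sigma>) (trm_l \<tau>)) bs)"
| "sub_trm \<rho> \<sigma> \<tau> (Delta v w) = Delta (sub_val \<rho> \<sigma> \<tau> v) (sub_val \<rho> \<sigma> \<tau> w)"
| "sub_stk \<rho> \<sigma> \<tau> (SVar \<alpha>) = \<sigma> \<alpha>"
| "sub_stk \<rho> \<sigma> \<tau> (Push v \<pi>) = Push (sub_val \<rho> \<sigma> \<tau> v) (sub_stk \<rho> \<sigma> \<tau> \<pi>)"
| "sub_stk \<rho> \<sigma> \<tau> (Frame t \<pi>) = Frame (sub_trm \<rho> \<sigma> \<tau> t) (sub_stk \<rho> \<sigma> \<tau> \<pi>)"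
| "sub_proc \<rho> \<sigma> \<tau> (t \<star> \<pi>) = sub_trm \<rho> \<sigma> \<tau> t \<star> sub_stk \<rho> \<sigma> \<tau> \<pi>"

definition subst_var :: "('l, 'c) trm \<Rightarrow> nat \<Rightarrow> ('l, 'c) val \<Rightarrow> ('l, 'c) trm"
    ("_[_ ::= _]" [1000, 0, 0] 1000) where
  "t[x ::= v] = sub_trm (Var(x := v)) SVar TVar t"

definition subst_svar :: "('l, 'c) trm \<Rightarrow> nat \<Rightarrow> ('l, 'c) stk \<Rightarrow> ('l, 'c) trm"
    ("_[_ ::=\<^sub>s _]" [1000, 0, 0] 1000) where
  "t[\<alpha> ::=\<^sub>s \<pi>] = sub_trm Var (SVar(\<alpha> := \<pi>)) TVar t"


section \<open>Named binders\<close>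

text \<open>\<open>bind x\<close> turns the name \<open>x\<close> into the bound index 0 and shifts every other name \<open>y\<close> to
  \<open>y + 1\<close>, its index below the new binder.\<close>

definition bind :: "nat \<Rightarrow> nat \<Rightarrow> nat" where
  "bind x y = (if y = x then 0 else Suc y)"

definition lam :: "nat \<Rightarrow> ('l, 'c) trm \<Rightarrow> ('l, 'c) val" where
  "lam x t = Lam (ren_trm (bind x) id t)"

definition mu :: "nat \<Rightarrow> ('l, 'c) trm \<Rightarrow> ('l, 'c) trm" where
  "mu \<alpha> t = Mu (ren_trm id (bind \<alpha>) t)"

text \<open>A branch \<open>C[x] \<rightarrow> t\<close> is the entry \<open>(x, t)\<close> at key \<open>C\<close>.\<close>

definition case_of :: "('l, 'c) val \<Rightarrow> ('c, nat \<times> ('l, 'c) trm) fmap \<Rightarrow> ('l, 'c) trm" where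
  "case_of v B = Case v (fmmap (\<lambda>(x, t). ren_trm (bind x) id t) B)"


section \<open>Reduction and observational equivalence\<close>

inductive_set red :: "(('l, 'c) proc \<times> ('l, 'c) proc) set" where
  app: "(App t u \<star> \<pi>, u \<star> Frame t \<pi>) \<in> red"
| frame: "(Val v \<star> Frame t \<pi>, t \<star> Push v \<pi>) \<in> red"
| beta: "(Val (lam x t) \<star> Push v \<pi>, t[x ::= v] \<star> \<pi>) \<in> red"
| mu: "(mu \<alpha> t \<star> \<pi>, t[\<alpha> ::=\<^sub>s \<pi>] \<star> \<pi>) \<in> red"
| prc: "(Prc p \<star> \<pi>, p) \<in> red"
| proj: "fmlookup r l = Some v \<Longrightarrow> (Proj (Rec r) l \<star> \<pi>, Val v \<star> \<pi>) \<in> red"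
| case_of: "fmlookup B c = Some (x, t) \<Longrightarrow>
    (case_of (Con c v) B \<star> \<pi>, t[x ::= v] \<star> \<pi>) \<in> red"

definition final :: "('l, 'c) proc \<Rightarrow> bool" where
  "final p \<longleftrightarrow> (\<exists>v \<alpha>. p = Val v \<star> SVar \<alpha>)"

definition converges :: "('l, 'c) proc \<Rightarrow> (('l, 'c) proc \<times> ('l, 'c) proc) set \<Rightarrow> bool"
    (infix "\<Down>" 50) where
  "p \<Down> R \<longleftrightarrow> (\<exists>q. (p, q) \<in> R\<^sup>* \<and> final q)"

context
  notes conj_cong [fundef_cong]
begin

function (sequential)
  step :: "nat \<Rightarrow> (('l, 'c) proc \<times> ('l, 'c) proc) set"
  and eqv :: "nat \<Rightarrow> ('l, 'c) trm \<Rightarrow> ('l, 'c) trm \<Rightarrow> bool"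
where
  "step i = red \<union> {(p, q). \<exists>v w \<pi>. p = Delta v w \<star> \<pi> \<and> q = Val v \<star> \<pi> \<and>
     (\<exists>j. j < i \<and> \<not> eqv j (Val v) (Val w))}"
| "eqv i t u = (\<forall>j. j \<le> i \<longrightarrow> (\<forall>\<pi> \<rho> \<sigma> \<tau>.
     (sub_trm \<rho> \<sigma> \<tau> t \<star> \<pi>) \<Down> step j \<longleftrightarrow> (sub_trm \<rho> \<sigma> \<tau> u \<star> \<pi>) \<Down> step j))"
  by pat_completeness auto
termination
  by (relation "measure (\<lambda>x. case x of Inl i \<Rightarrow> 2 * i | Inr (i, _, _) \<Rightarrow> 2 * i + 1)") auto

end

declare step.simps [simp del] eqv.simps [simp del]

definition equivalent :: "('l, 'c) trm \<Rightarrow> ('l, 'c) trm \<Rightarrow> bool"  (infix "\<approx>" 50) where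
  "t \<approx> u \<longleftrightarrow> (\<forall>i. eqv i t u)"

end

theory Submission
  imports Defs
begin

text \<open>
  After any substitution, each of the two redexes reduces in finitely many steps to the
  corresponding substitution instance, by commutation of substitution with the instantiation
  of a bound variable. Every process on the way is non-final and has exactly one successor under
  every \<open>step j\<close>, so convergence is preserved in both directions. Since the rules of
  \<open>red\<close> mention named binders, firing one on a de Bruijn term requires a name that is fresh
  for its body; it exists because terms have finitely many free variables.
\<close>

section \<open>Composition of renamings and substitutions\<close>

lemma up_comp: "up f (up f' n) = up (\<lambda>m. f (f' m)) n"
  by (cases n) (simp_all add: up_def)

lemma up_id [simp]: "up (\<lambda>x. x) = (\<lambda>x. x)"
  by (rule ext) (simp add: up_def split: nat.split)

lemma up_0 [simp]: "up f 0 = 0"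
  by (simp add: up_def)

lemma up_Suc [simp]: "up f (Suc n) = Suc (f n)"
  by (simp add: up_def)

text \<open>First of four composition laws, each of which must pass the shifts made by lifting:
  \<open>ren_sub\<close> rests on \<open>ren_ren\<close>, and \<open>sub_sub\<close> on
  \<open>sub_ren\<close> and \<open>ren_sub\<close>.\<close>

lemma ren_ren:
  fixes v :: "('l, 'c) val" and t :: "('l, 'c) trm" and \<pi> :: "('l, 'c) stk" and p :: "('l, 'c) proc"
  shows "ren_val f g (ren_val f' g' v) = ren_val (\<lambda>n. f (f' n)) (\<lambda>n. g (g' n)) v"
    and "ren_trm f g (ren_trm f' g' t) = ren_trm (\<lambda>n. f (f' n)) (\<lambda>n. g (g' n)) t"
    and "ren_stk f g (ren_stk f' g' \<pi>) = ren_stk (\<lambda>n. f (f' n)) (\<lambda>n. g (g' n)) \<pi>"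
    and "ren_proc f g (ren_proc f' g' p) = ren_proc (\<lambda>n. f (f' n)) (\<lambda>n. g (g' n)) p"
  by (induction v and t and \<pi> and p arbitrary: f g f' g' and f g f' g' and f g f' g' and f g f' g'
      rule: val.induct trm.induct stk.induct proc.induct)
    (auto simp: up_comp fmap.map_comp intro!: fmap.map_cong)

lemma sub_ren:
  fixes v :: "('l, 'c) val" and t :: "('l, 'c) trm" and \<pi> :: "('l, 'c) stk" and p :: "('l, 'c) proc"
  shows "sub_val \<rho> \<sigma> \<tau> (ren_val f g v) = sub_val (\<lambda>n. \<rho> (f n)) (\<lambda>n. \<sigma> (g n)) \<tau> v"
    and "sub_trm \<rho> \<sigma> \<tau> (ren_trm f g t) = sub_trm (\<lambda>n. \<rho> (f n)) (\<lambda>n. \<sigma> (g n)) \<tau> t"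
    and "sub_stk \<rho> \<sigma> \<tau> (ren_stk f g \<pi>) = sub_stk (\<lambda>n. \<rho> (f n)) (\<lambda>n. \<sigma> (g n)) \<tau> \<pi>"
    and "sub_proc \<rho> \<sigma> \<tau> (ren_proc f g p) = sub_proc (\<lambda>n. \<rho> (f n)) (\<lambda>n. \<sigma> (g n)) \<tau> p"
proof -
  have l: "(\<lambda>n. val_l \<rho> (up f n)) = val_l (\<lambda>n. \<rho> (f n))" for \<rho> :: "nat \<Rightarrow> ('l, 'c) val" and f
    by (rule ext) (simp add: val_l_def up_def split: nat.split)
  have s: "(\<lambda>n. stk_s \<sigma> (up g n)) = stk_s (\<lambda>n. \<sigma> (g n))" for \<sigma> :: "nat \<Rightarrow> ('l, 'c) stk" and g
    by (rule ext) (simp add: stk_s_def up_def split: nat.split)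
  note eqs = l s stk_l_def val_s_def
  show "sub_val \<rho> \<sigma> \<tau> (ren_val f g v) = sub_val (\<lambda>n. \<rho> (f n)) (\<lambda>n. \<sigma> (g n)) \<tau> v"
    and "sub_trm \<rho> \<sigma> \<tau> (ren_trm f g t) = sub_trm (\<lambda>n. \<rho> (f n)) (\<lambda>n. \<sigma> (g n)) \<tau> t"
    and "sub_stk \<rho> \<sigma> \<tau> (ren_stk f g \<pi>) = sub_stk (\<lambda>n. \<rho> (f n)) (\<lambda>n. \<sigma> (g n)) \<tau> \<pi>"
    and "sub_proc \<rho> \<sigma> \<tau> (ren_proc f g p) = sub_proc (\<lambda>n. \<rho> (f n)) (\<lambda>n. \<sigma> (g n)) \<tau> p"
    by (induction v and t and \<pi> and p arbitrary: \<rho> \<sigma> \<tau> f g and \<rho> \<sigma> \<tau> f g and \<rho> \<sigma> \<tau> f g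
        and \<rho> \<sigma> \<tau> f g rule: val.induct trm.induct stk.induct proc.induct)
      (auto simp: eqs fmap.map_comp intro!: fmap.map_cong)
qed

lemma ren_sub:
  fixes v :: "('l, 'c) val" and t :: "('l, 'c) trm" and \<pi> :: "('l, 'c) stk" and p :: "('l, 'c) proc"
  shows "ren_val f g (sub_val \<rho> \<sigma> \<tau> v) =
      sub_val (\<lambda>n. ren_val f g (\<rho> n)) (\<lambda>n. ren_stk f g (\<sigma> n)) (\<lambda>n. ren_trm f g (\<tau> n)) v"
    and "ren_trm f g (sub_trm \<rho> \<sigma> \<tau> t) =
      sub_trm (\<lambda>n. ren_val f g (\<rho> n)) (\<lambda>n. ren_stk f g (\<sigma> n)) (\<lambda>n. ren_trm f g (\<tau> n)) t"
    and "ren_stk f g (sub_stk \<rho> \<sigma> \<tau> \<pi>) =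
      sub_stk (\<lambda>n. ren_val f g (\<rho> n)) (\<lambda>n. ren_stk f g (\<sigma> n)) (\<lambda>n. ren_trm f g (\<tau> n)) \<pi>"
    and "ren_proc f g (sub_proc \<rho> \<sigma> \<tau> p) =
      sub_proc (\<lambda>n. ren_val f g (\<rho> n)) (\<lambda>n. ren_stk f g (\<sigma> n)) (\<lambda>n. ren_trm f g (\<tau> n)) p"
proof -
  \<comment> \<open>These settle the binder cases: transforming a lifted map is lifting the
    transformed map. The new index 0 is fixed by \<open>up\<close>, and elsewhere \<open>up\<close>
    commutes with the shift \<open>Suc\<close>.\<close>
  have eqs:
    "(\<lambda>n. ren_val (up f) g (val_l \<rho> n)) = val_l (\<lambda>n. ren_val f g (\<rho> n))"
    "(\<lambda>n. ren_stk (up f) g (stk_l \<sigma> n)) = stk_l (\<lambda>n. ren_stk f g (\<sigma> n))"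
    "(\<lambda>n. ren_trm (up f) g (trm_l \<tau> n)) = trm_l (\<lambda>n. ren_trm f g (\<tau> n))"
    "(\<lambda>n. ren_val f (up g) (val_s \<rho> n)) = val_s (\<lambda>n. ren_val f g (\<rho> n))"
    "(\<lambda>n. ren_stk f (up g) (stk_s \<sigma> n)) = stk_s (\<lambda>n. ren_stk f g (\<sigma> n))"
    "(\<lambda>n. ren_trm f (up g) (trm_s \<tau> n)) = trm_s (\<lambda>n. ren_trm f g (\<tau> n))"
    for f g and \<rho> :: "nat \<Rightarrow> ('l, 'c) val" and \<sigma> :: "nat \<Rightarrow> ('l, 'c) stk"
      and \<tau> :: "nat \<Rightarrow> ('l, 'c) trm"
    by (auto simp: fun_eq_iff val_l_def stk_l_def trm_l_def val_s_def stk_s_def trm_s_def ren_ren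
        split: nat.split)
  show "ren_val f g (sub_val \<rho> \<sigma> \<tau> v) =
      sub_val (\<lambda>n. ren_val f g (\<rho> n)) (\<lambda>n. ren_stk f g (\<sigma> n)) (\<lambda>n. ren_trm f g (\<tau> n)) v"
    and "ren_trm f g (sub_trm \<rho> \<sigma> \<tau> t) =
      sub_trm (\<lambda>n. ren_val f g (\<rho> n)) (\<lambda>n. ren_stk f g (\<sigma> n)) (\<lambda>n. ren_trm f g (\<tau> n)) t"
    and "ren_stk f g (sub_stk \<rho> \<sigma> \<tau> \<pi>) =
      sub_stk (\<lambda>n. ren_val f g (\<rho> n)) (\<lambda>n. ren_stk f g (\<sigma> n)) (\<lambda>n. ren_trm f g (\<tau> n)) \<pi>"
    and "ren_proc f g (sub_proc \<rho> \<sigma> \<tau> p) =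
      sub_proc (\<lambda>n. ren_val f g (\<rho> n)) (\<lambda>n. ren_stk f g (\<sigma> n)) (\<lambda>n. ren_trm f g (\<tau> n)) p"
    by (induction v and t and \<pi> and p arbitrary: \<rho> \<sigma> \<tau> f g and \<rho> \<sigma> \<tau> f g and \<rho> \<sigma> \<tau> f g
        and \<rho> \<sigma> \<tau> f g rule: val.induct trm.induct stk.induct proc.induct)
      (auto simp: eqs fmap.map_comp intro!: fmap.map_cong)
qed

lemma sub_sub:
  fixes v :: "('l, 'c) val" and t :: "('l, 'c) trm" and \<pi> :: "('l, 'c) stk" and p :: "('l, 'c) proc"
  shows "sub_val \<rho> \<sigma> \<tau> (sub_val \<rho>' \<sigma>' \<tau>' v) =
      sub_val (\<lambda>n. sub_val \<rho> \<sigma> \<tau> (\<rho>' n)) (\<lambda>n. sub_stk \<rho> \<sigma> \<tau> (\<sigma>' n)) (\<lambda>n. sub_trm \<rho> \<sigma> \<tau> (\<tau>' n)) v"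
    and "sub_trm \<rho> \<sigma> \<tau> (sub_trm \<rho>' \<sigma>' \<tau>' t) =
      sub_trm (\<lambda>n. sub_val \<rho> \<sigma> \<tau> (\<rho>' n)) (\<lambda>n. sub_stk \<rho> \<sigma> \<tau> (\<sigma>' n)) (\<lambda>n. sub_trm \<rho> \<sigma> \<tau> (\<tau>' n)) t"
    and "sub_stk \<rho> \<sigma> \<tau> (sub_stk \<rho>' \<sigma>' \<tau>' \<pi>) =
      sub_stk (\<lambda>n. sub_val \<rho> \<sigma> \<tau> (\<rho>' n)) (\<lambda>n. sub_stk \<rho> \<sigma> \<tau> (\<sigma>' n)) (\<lambda>n. sub_trm \<rho> \<sigma> \<tau> (\<tau>' n)) \<pi>"
    and "sub_proc \<rho> \<sigma> \<tau> (sub_proc \<rho>' \<sigma>' \<tau>' p) =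
      sub_proc (\<lambda>n. sub_val \<rho> \<sigma> \<tau> (\<rho>' n)) (\<lambda>n. sub_stk \<rho> \<sigma> \<tau> (\<sigma>' n)) (\<lambda>n. sub_trm \<rho> \<sigma> \<tau> (\<tau>' n)) p"
proof -
  \<comment> \<open>Here a substitution meets a shifted image. \<open>sub_ren\<close> on the left
    and \<open>ren_sub\<close> on the right leave the same substitution of the unshifted
    image.\<close>
  have eqs:
    "(\<lambda>n. sub_val (val_l \<rho>) (stk_l \<sigma>) (trm_l \<tau>) (val_l \<rho>' n)) = val_l (\<lambda>n. sub_val \<rho> \<sigma> \<tau> (\<rho>' n))"
    "(\<lambda>n. sub_stk (val_l \<rho>) (stk_l \<sigma>) (trm_l \<tau>) (stk_l \<sigma>' n)) = stk_l (\<lambda>n. sub_stk \<rho> \<sigma> \<tau> (\<sigma>' n))"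
    "(\<lambda>n. sub_trm (val_l \<rho>) (stk_l \<sigma>) (trm_l \<tau>) (trm_l \<tau>' n)) = trm_l (\<lambda>n. sub_trm \<rho> \<sigma> \<tau> (\<tau>' n))"
    "(\<lambda>n. sub_val (val_s \<rho>) (stk_s \<sigma>) (trm_s \<tau>) (val_s \<rho>' n)) = val_s (\<lambda>n. sub_val \<rho> \<sigma> \<tau> (\<rho>' n))"
    "(\<lambda>n. sub_stk (val_s \<rho>) (stk_s \<sigma>) (trm_s \<tau>) (stk_s \<sigma>' n)) = stk_s (\<lambda>n. sub_stk \<rho> \<sigma> \<tau> (\<sigma>' n))"
    "(\<lambda>n. sub_trm (val_s \<rho>) (stk_s \<sigma>) (trm_s \<tau>) (trm_s \<tau>' n)) = trm_s (\<lambda>n. sub_trm \<rho> \<sigma> \<tau> (\<tau>' n))"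
    for \<rho> \<rho>' :: "nat \<Rightarrow> ('l, 'c) val" and \<sigma> \<sigma>' :: "nat \<Rightarrow> ('l, 'c) stk"
      and \<tau> \<tau>' :: "nat \<Rightarrow> ('l, 'c) trm"
    by (auto simp: fun_eq_iff val_l_def stk_l_def trm_l_def val_s_def stk_s_def trm_s_def
        sub_ren ren_sub split: nat.split)
  \<comment> \<open>With the statements themselves in place of these constants, the higher-order unification
    against the induction rules explodes.\<close>
  define Pval where "Pval v \<longleftrightarrow> (\<forall>\<rho> \<sigma> \<tau> \<rho>' \<sigma>' \<tau>'. sub_val \<rho> \<sigma> \<tau> (sub_val \<rho>' \<sigma>' \<tau>' v) =
      sub_val (\<lambda>n. sub_val \<rho> \<sigma> \<tau> (\<rho>' n)) (\<lambda>n. sub_stk \<rho> \<sigma> \<tau> (\<sigma>' n)) (\<lambda>n. sub_trm \<rho> \<sigma> \<tau> (\<tau>' n)) v)"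
    for v :: "('l, 'c) val"
  define Ptrm where "Ptrm t \<longleftrightarrow> (\<forall>\<rho> \<sigma> \<tau> \<rho>' \<sigma>' \<tau>'. sub_trm \<rho> \<sigma> \<tau> (sub_trm \<rho>' \<sigma>' \<tau>' t) =
      sub_trm (\<lambda>n. sub_val \<rho> \<sigma> \<tau> (\<rho>' n)) (\<lambda>n. sub_stk \<rho> \<sigma> \<tau> (\<sigma>' n)) (\<lambda>n. sub_trm \<rho> \<sigma> \<tau> (\<tau>' n)) t)"
    for t :: "('l, 'c) trm"
  define Pstk where "Pstk \<pi> \<longleftrightarrow> (\<forall>\<rho> \<sigma> \<tau> \<rho>' \<sigma>' \<tau>'. sub_stk \<rho> \<sigma> \<tau> (sub_stk \<rho>' \<sigma>' \<tau>' \<pi>) =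
      sub_stk (\<lambda>n. sub_val \<rho> \<sigma> \<tau> (\<rho>' n)) (\<lambda>n. sub_stk \<rho> \<sigma> \<tau> (\<sigma>' n)) (\<lambda>n. sub_trm \<rho> \<sigma> \<tau> (\<tau>' n)) \<pi>)"
    for \<pi> :: "('l, 'c) stk"
  define Pproc where "Pproc p \<longleftrightarrow> (\<forall>\<rho> \<sigma> \<tau> \<rho>' \<sigma>' \<tau>'. sub_proc \<rho> \<sigma> \<tau> (sub_proc \<rho>' \<sigma>' \<tau>' p) =
      sub_proc (\<lambda>n. sub_val \<rho> \<sigma> \<tau> (\<rho>' n)) (\<lambda>n. sub_stk \<rho> \<sigma> \<tau> (\<sigma>' n)) (\<lambda>n. sub_trm \<rho> \<sigma> \<tau> (\<tau>' n)) p)"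
    for p :: "('l, 'c) proc"
  note P_defs = Pval_def Ptrm_def Pstk_def Pproc_def
  have all: "Pval v" "Ptrm t" "Pstk \<pi>" "Pproc p"
    by (induction v and t and \<pi> and p rule: val.induct trm.induct stk.induct proc.induct)
      (simp_all add: P_defs eqs fmap.map_comp comp_def cong: fmap.map_cong)
  show "sub_val \<rho> \<sigma> \<tau> (sub_val \<rho>' \<sigma>' \<tau>' v) =
      sub_val (\<lambda>n. sub_val \<rho> \<sigma> \<tau> (\<rho>' n)) (\<lambda>n. sub_stk \<rho> \<sigma> \<tau> (\<sigma>' n)) (\<lambda>n. sub_trm \<rho> \<sigma> \<tau> (\<tau>' n)) v"
    and "sub_trm \<rho> \<sigma> \<tau> (sub_trm \<rho>' \<sigma>' \<tau>' t) =
      sub_trm (\<lambda>n. sub_val \<rho> \<sigma> \<tau> (\<rho>' n)) (\<lambda>n. sub_stk \<rho> \<sigma> \<tau> (\<sigma>' n)) (\<lambda>n. sub_trm \<rho> \<sigma> \<tau> (\<tau>' n)) t"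
    and "sub_stk \<rho> \<sigma> \<tau> (sub_stk \<rho>' \<sigma>' \<tau>' \<pi>) =
      sub_stk (\<lambda>n. sub_val \<rho> \<sigma> \<tau> (\<rho>' n)) (\<lambda>n. sub_stk \<rho> \<sigma> \<tau> (\<sigma>' n)) (\<lambda>n. sub_trm \<rho> \<sigma> \<tau> (\<tau>' n)) \<pi>"
    and "sub_proc \<rho> \<sigma> \<tau> (sub_proc \<rho>' \<sigma>' \<tau>' p) =
      sub_proc (\<lambda>n. sub_val \<rho> \<sigma> \<tau> (\<rho>' n)) (\<lambda>n. sub_stk \<rho> \<sigma> \<tau> (\<sigma>' n)) (\<lambda>n. sub_trm \<rho> \<sigma> \<tau> (\<tau>' n)) p"
    using all unfolding P_defs by (simp_all only:)
qed

lemma ren_id: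
  fixes v :: "('l, 'c) val" and t :: "('l, 'c) trm" and \<pi> :: "('l, 'c) stk" and p :: "('l, 'c) proc"
  shows "ren_val (\<lambda>x. x) (\<lambda>x. x) v = v" and "ren_trm (\<lambda>x. x) (\<lambda>x. x) t = t"
    and "ren_stk (\<lambda>x. x) (\<lambda>x. x) \<pi> = \<pi>" and "ren_proc (\<lambda>x. x) (\<lambda>x. x) p = p"
  by (induction v and t and \<pi> and p rule: val.induct trm.induct stk.induct proc.induct)
    (auto intro!: fmap.map_ident_strong)

lemma sub_id:
  fixes v :: "('l, 'c) val" and t :: "('l, 'c) trm" and \<pi> :: "('l, 'c) stk" and p :: "('l, 'c) proc"
  shows "sub_val Var SVar TVar v = v" and "sub_trm Var SVar TVar t = t"
    and "sub_stk Var SVar TVar \<pi> = \<pi>" and "sub_proc Var SVar TVar p = p"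
proof -
  \<comment> \<open>The identity maps are fixed by every lifting, so the induction hypotheses apply
    below binders as they stand.\<close>
  have [simp]: "val_l Var = (Var :: nat \<Rightarrow> ('l, 'c) val)" "stk_l SVar = (SVar :: nat \<Rightarrow> ('l, 'c) stk)"
    "trm_l TVar = (TVar :: nat \<Rightarrow> ('l, 'c) trm)" "val_s Var = (Var :: nat \<Rightarrow> ('l, 'c) val)"
    "stk_s SVar = (SVar :: nat \<Rightarrow> ('l, 'c) stk)" "trm_s TVar = (TVar :: nat \<Rightarrow> ('l, 'c) trm)"
    by (auto simp: fun_eq_iff val_l_def stk_l_def trm_l_def val_s_def stk_s_def trm_s_def
        split: nat.split)
  show "sub_val Var SVar TVar v = v" and "sub_trm Var SVar TVar t = t"
    and "sub_stk Var SVar TVar \<pi> = \<pi>" and "sub_proc Var SVar TVar p = p"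
    by (induction v and t and \<pi> and p rule: val.induct trm.induct stk.induct proc.induct)
      (auto intro!: fmap.map_ident_strong)
qed


section \<open>Named binders\<close>

text \<open>The lifted maps agree even below \<open>Suc N\<close>; the weaker bound \<open>N\<close>
  lets one threshold serve both a body and its abstraction.\<close>

lemma up_eq: "\<forall>n<N. f n = f' n \<Longrightarrow> \<forall>n<N. up f n = up f' n"
  by (auto simp: up_def split: nat.split)

text \<open>Expresses without a free-variable function that all free \<lambda>-variables lie below
  some \<open>N\<close>. With \<open>eventually\<close>, thresholds of several subterms combine
  without explicit maxima.\<close>

lemma finitely_many_free_variables:
  fixes v :: "('l, 'c) val" and t :: "('l, 'c) trm" and \<pi> :: "('l, 'c) stk" and p :: "('l, 'c) proc"
  shows "\<forall>\<^sub>F N in sequentially. \<forall>f f' g. (\<forall>n<N. f n = f' n) \<longrightarrow> ren_val f g v = ren_val f' g v"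
    and "\<forall>\<^sub>F N in sequentially. \<forall>f f' g. (\<forall>n<N. f n = f' n) \<longrightarrow> ren_trm f g t = ren_trm f' g t"
    and "\<forall>\<^sub>F N in sequentially. \<forall>f f' g. (\<forall>n<N. f n = f' n) \<longrightarrow> ren_stk f g \<pi> = ren_stk f' g \<pi>"
    and "\<forall>\<^sub>F N in sequentially. \<forall>f f' g. (\<forall>n<N. f n = f' n) \<longrightarrow> ren_proc f g p = ren_proc f' g p"
proof (induction v and t and \<pi> and p rule: val.induct trm.induct stk.induct proc.induct)
  case (Var x)
  show ?case using eventually_gt_at_top[of x] by eventually_elim simp
next
  case (Lam t)
  then show ?case by eventually_elim (auto dest: up_eq)
next
  case (Rec r)
  \<comment> \<open>A finite map has finitely many entries, so one threshold serves all of
    them.\<close>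
  then have "\<forall>\<^sub>F N in sequentially. \<forall>v\<in>fmran' r. \<forall>f f' g. (\<forall>n<N. f n = f' n) \<longrightarrow>
      ren_val f g v = ren_val f' g v"
    by (intro eventually_ball_finite) (simp_all add: fmran'_alt_def)
  then show ?case by eventually_elim (auto intro!: fmap.map_cong)
next
  case (Case v bs)
  then have "\<forall>\<^sub>F N in sequentially. \<forall>t\<in>fmran' bs. \<forall>f f' g. (\<forall>n<N. f n = f' n) \<longrightarrow>
      ren_trm f g t = ren_trm f' g t"
    by (intro eventually_ball_finite) (simp_all add: fmran'_alt_def)
  with Case(1) show ?case
    by eventually_elim (auto intro!: fmap.map_cong dest: up_eq)
next
  case (App t u)
  then show ?case by eventually_elim auto
next
  case (Delta v w)
  then show ?case by eventually_elim auto
next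
  case (Push v \<pi>)
  then show ?case by eventually_elim auto
next
  case (Frame t \<pi>)
  then show ?case by eventually_elim auto
next
  case (Proc t \<pi>)
  then show ?case by eventually_elim auto
qed (auto elim!: eventually_mono)

lemma ex_named:
  fixes s :: "('l, 'c) trm"
  shows "\<exists>x t. s = ren_trm (bind x) id t"
proof -
  obtain N where N: "\<And>f f' g. (\<forall>n<N. f n = f' n) \<Longrightarrow> ren_trm f g s = ren_trm f' g s"
    using finitely_many_free_variables(2)[of s] unfolding eventually_sequentially by blast
  \<comment> \<open>The name \<open>N\<close> lies above all free indices of \<open>s\<close>. The
    inner renaming gives this name to index 0 and lowers the others by one; \<open>bind N\<close>
    undoes it except at index \<open>Suc N\<close>, which does not occur in
    \<open>s\<close>.\<close>
  have "ren_trm (bind N) id (ren_trm (case_nat N (\<lambda>n. n)) id s) =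
      ren_trm (\<lambda>x. x) (\<lambda>x. x) s"
    unfolding ren_ren id_apply
    by (rule N) (auto simp: bind_def split: nat.split)
  then show ?thesis by (metis ren_id(2))
qed

text \<open>De Bruijn instantiation of a body whose binder is removed: index 0 becomes
  \<open>v\<close>, every other index drops by one. No name is chosen, so reducts can be compared in
  this form.\<close>

definition inst :: "('l, 'c) val \<Rightarrow> ('l, 'c) trm \<Rightarrow> ('l, 'c) trm" where
  "inst v = sub_trm (case_nat v Var) SVar TVar"

lemma inst_bind: "inst v (ren_trm (bind x) id t) = t[x ::= v]"
proof -
  have "(\<lambda>n. case_nat v Var (bind x n)) = Var(x := v)"
    by (auto simp: bind_def)
  then show ?thesis by (simp add: inst_def subst_var_def sub_ren)
qed

lemma inst_sub:
  "inst (sub_val \<rho> \<sigma> \<tau> v) (sub_trm (val_l \<rho>) (stk_l \<sigma>) (trm_l \<tau>) t) = sub_trm \<rho> \<sigma> \<tau> (inst v t)"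
proof -
  \<comment> \<open>At index 0 both sides are the substituted value; at \<open>Suc n\<close> the
    instantiation cancels the shift of \<open>\<rho> n\<close>.\<close>
  have "(\<lambda>n. sub_val (case_nat w Var) SVar TVar (val_l \<rho> n)) = (\<lambda>n. sub_val \<rho> \<sigma> \<tau> (case_nat v Var n))"
    if "w = sub_val \<rho> \<sigma> \<tau> v" for w
    using that by (auto simp: fun_eq_iff val_l_def sub_ren sub_id split: nat.split)
  then show ?thesis
    by (simp add: inst_def sub_sub sub_ren sub_id stk_l_def trm_l_def)
qed

text \<open>Oriented so that the right-hand term of each equivalence takes the shape of the reduct
  of the substituted redex.\<close>

lemma sub_subst_var:
  "sub_trm \<rho> \<sigma> \<tau> (t[x ::= v]) =
    inst (sub_val \<rho> \<sigma> \<tau> v) (sub_trm (val_l \<rho>) (stk_l \<sigma>) (trm_l \<tau>) (ren_trm (bind x) id t))"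
  by (simp add: inst_sub inst_bind)


section \<open>Determinism of the redexes\<close>

lemma red_App_iff: "(App t u \<star> \<pi>, q) \<in> red \<longleftrightarrow> q = u \<star> Frame t \<pi>"
  by (auto elim: red.cases intro: red.intros simp: mu_def case_of_def)

lemma red_Frame_iff: "(Val v \<star> Frame t \<pi>, q) \<in> red \<longleftrightarrow> q = t \<star> Push v \<pi>"
  by (auto elim: red.cases intro: red.intros simp: mu_def case_of_def)

text \<open>\<open>ex_named\<close> supplies a named form, hence a reduct; by
  \<open>inst_bind\<close> every named form yields the same one.\<close>

lemma red_Lam_iff: "(Val (Lam s) \<star> Push v \<pi>, q) \<in> red \<longleftrightarrow> q = inst v s \<star> \<pi>"
proof
  assume "(Val (Lam s) \<star> Push v \<pi>, q) \<in> red"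
  then show "q = inst v s \<star> \<pi>"
    by cases (auto simp: lam_def mu_def case_of_def inst_bind)
next
  obtain x t where "s = ren_trm (bind x) id t" using ex_named by blast
  then show "q = inst v s \<star> \<pi> \<Longrightarrow> (Val (Lam s) \<star> Push v \<pi>, q) \<in> red"
    using red.beta[of x t v \<pi>] by (simp add: lam_def inst_bind)
qed

lemma red_Case_iff:
  fixes s :: "('l, 'c) trm"
  assumes "fmlookup bs c = Some s"
  shows "(Case (Con c v) bs \<star> \<pi>, q) \<in> red \<longleftrightarrow> q = inst v s \<star> \<pi>"
proof
  assume "(Case (Con c v) bs \<star> \<pi>, q) \<in> red"
  then show "q = inst v s \<star> \<pi>"
    by cases (use assms in \<open>auto simp: mu_def case_of_def inst_bind\<close>)
next
  \<comment> \<open>The rule \<open>red.case_of\<close> wants all branches named at once, so one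
    function selects a named form of every term and is mapped over \<open>bs\<close>.\<close>
  obtain nm where nm: "\<And>s :: ('l, 'c) trm. case nm s of (x, t) \<Rightarrow> ren_trm (bind x) id t = s"
  proof -
    have "\<exists>z. case z of (x, t) \<Rightarrow> ren_trm (bind x) id t = s" for s :: "('l, 'c) trm"
      using ex_named[of s] by auto
    then show thesis using that by metis
  qed
  obtain x t where xt: "nm s = (x, t)" by force
  have eq: "case_of w (fmmap nm bs) = Case w bs" for w
    using nm by (simp add: case_of_def fmap.map_comp comp_def case_prod_beta fmap.map_ident)
  have "(case_of (Con c v) (fmmap nm bs) \<star> \<pi>, t[x ::= v] \<star> \<pi>) \<in> red"
    using assms xt by (intro red.case_of) simp
  then show "q = inst v s \<star> \<pi> \<Longrightarrow> (Case (Con c v) bs \<star> \<pi>, q) \<in> red"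
    using nm[of s] xt by (auto simp: eq inst_bind)
qed

section \<open>Convergence along forced steps\<close>

lemma converges_unique_successor:
  assumes "\<And>r. (p, r) \<in> R \<longleftrightarrow> r = q" and "\<not> final p"
  shows "p \<Down> R \<longleftrightarrow> q \<Down> R"
  \<comment> \<open>A path from the non-final \<open>p\<close> to a final process is nonempty, so it
    passes through \<open>q\<close>; conversely a path from \<open>q\<close> is extended by the step
    from \<open>p\<close>.\<close>
  unfolding converges_def using assms
  by (metis converse_rtranclE converse_rtrancl_into_rtrancl)

text \<open>All pairs that \<open>step\<close> adds to \<open>red\<close> start at a
  \<open>Delta\<close>, so on other terms the level \<open>j\<close> and the relation
  \<open>eqv\<close> have no influence.\<close>

lemma step_iff_red: "(t \<star> \<pi>, q) \<in> step j \<longleftrightarrow> (t \<star> \<pi>, q) \<in> red" if "\<And>v w. t \<noteq> Delta v w"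
  using that by (auto simp: step.simps)

lemma converges_App: "App t u \<star> \<pi> \<Down> step j \<longleftrightarrow> u \<star> Frame t \<pi> \<Down> step j"
  by (rule converges_unique_successor) (auto simp: step_iff_red red_App_iff final_def)

lemma converges_Frame: "Val v \<star> Frame t \<pi> \<Down> step j \<longleftrightarrow> t \<star> Push v \<pi> \<Down> step j"
  by (rule converges_unique_successor) (auto simp: step_iff_red red_Frame_iff final_def)

lemma converges_Lam: "Val (Lam s) \<star> Push v \<pi> \<Down> step j \<longleftrightarrow> inst v s \<star> \<pi> \<Down> step j"
  by (rule converges_unique_successor) (auto simp: step_iff_red red_Lam_iff final_def)

lemma converges_Case:
  "fmlookup bs c = Some s \<Longrightarrow> Case (Con c v) bs \<star> \<pi> \<Down> step j \<longleftrightarrow> inst v s \<star> \<pi> \<Down> step j"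
  by (rule converges_unique_successor) (auto simp: step_iff_red red_Case_iff final_def)

section \<open>The two equivalences\<close>

lemma equivalentI:
  assumes "\<And>j \<pi> \<rho> \<sigma> \<tau>. sub_trm \<rho> \<sigma> \<tau> t \<star> \<pi> \<Down> step j \<longleftrightarrow> sub_trm \<rho> \<sigma> \<tau> u \<star> \<pi> \<Down> step j"
  shows "t \<approx> u"
  using assms by (simp add: equivalent_def eqv.simps)

text \<open>Three forced steps: the argument is evaluated first with the function in a frame, then
  it is pushed, then the abstraction fires.\<close>

lemma beta_equivalent: "App (Val (lam x t)) (Val v) \<approx> t[x ::= v]"
  by (rule equivalentI)
    (simp add: lam_def converges_App converges_Frame converges_Lam sub_subst_var)

text \<open>Substitution maps over the branches and keeps their keys and the constructor
  \<open>c\<close>, so the redex still selects the same branch.\<close>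

lemma case_equivalent:
  assumes "fmlookup B c = Some (x, t)"
  shows "case_of (Con c v) B \<approx> t[x ::= v]"
  by (rule equivalentI) (simp add: case_of_def assms converges_Case sub_subst_var)

theorem theorem10:
  shows "(\<forall>(x::nat) (t::('l::countable, 'c::countable) trm) (v::('l, 'c) val).
            App (Val (lam x t)) (Val v) \<approx> t[x ::= v]) \<and>
         (\<forall>(n::nat) (C::nat \<Rightarrow> 'c) (x::nat \<Rightarrow> nat) (t::nat \<Rightarrow> ('l, 'c) trm) (v::('l, 'c) val) (k::nat).
            inj_on C {1..n} \<longrightarrow> 1 \<le> k \<longrightarrow> k \<le> n \<longrightarrow>
            case_of (Con (C k) v) (fmap_of_list (map (\<lambda>i. (C i, (x i, t i))) [1..<Suc n]))
              \<approx> (t k)[x k ::= v])"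
proof (intro conjI allI impI)
  fix x and t :: "('l, 'c) trm" and v
  show "App (Val (lam x t)) (Val v) \<approx> t[x ::= v]" by (rule beta_equivalent)
next
  fix n k :: nat and C :: "nat \<Rightarrow> 'c" and x :: "nat \<Rightarrow> nat" and t :: "nat \<Rightarrow> ('l, 'c) trm" and v
  assume inj: "inj_on C {1..n}" and k: "1 \<le> k" "k \<le> n"
  \<comment> \<open>Distinct constructors ensure that looking up \<open>C k\<close> finds the k-th
    branch. Removing \<open>upt_Suc\<close> keeps the list \<open>[1..<Suc n]\<close> whole.\<close>
  have "distinct (map C [1..<Suc n])"
    using inj by (simp add: distinct_map atLeastLessThanSuc_atLeastAtMost del: upt_Suc)
  then have "map_of (map (\<lambda>i. (C i, (x i, t i))) [1..<Suc n]) (C k) = Some (x k, t k)"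
    using k by (intro map_of_is_SomeI) (auto simp: comp_def simp del: upt_Suc)
  then show "case_of (Con (C k) v) (fmap_of_list (map (\<lambda>i. (C i, (x i, t i))) [1..<Suc n]))
      \<approx> (t k)[x k ::= v]"
    by (intro case_equivalent) (simp add: fmlookup_of_list del: upt_Suc)
qed

end
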